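(* Let $R$ be a commutative $K$-algebra ($K$ a perfect field). For matrices $M_1,\dots,M_n\in\mathbb M_d(R)$ we have $$\det(M_1+\cdots+M_n)=\sum_{I,\sigma}\mathrm{sgn}(\sigma)\,\Delta_{I_1\sigma(I_1)}(M_1)\cdots\Delta_{I_n\sigma(I_n)}(M_n),$$ where the sum is taken over all ordered partitions $I=(I_1,\dots,I_n)$ of $\{1,\dots,d\}$ and all $I$-shuffles $\sigma\in S_d$. In particular, when $n=2$ we can write this, for $M,N\in\mathbb M_d(R)$, as $$\det(M+N)=\sum_{\substack{I=\{i_1,\dots,i_a\}\\ J=\{j_1,\dots,j_a\}}}(-1)^{i_1+j_1+\cdots+i_a+j_a}\,\Delta_{IJ}(M)\,\Delta_{I^cJ^c}(N),$$ the sum being over all pairs of subsets $I,J\subset\{1,\dots,d\}$ of equal size $a$ ($0\le a\le d$), and $I^c$ denoting the complement of $I$.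
   Context: An ordered partition $I=(I_1,\dots,I_n)$ of $\{1,\dots,d\}$ is an ordered tuple of pairwise disjoint (possibly empty) subsets with union $\{1,\dots,d\}$. A permutation $\sigma\in S_d$ is an $I$-shuffle if it preserves the ordering of the elements in each $I_i$ (i.e. $\sigma|_{I_i}$ is increasing). For subsets $I,J$ of $\{1,\dots,d\}$ of the same size $r$ and $M\in\mathbb M_d(R)$, $\Delta_{IJ}(M)$ is the $r\times r$ minor formed from the rows indexed by $I$ and the columns indexed by $J$ (equal to $1$ when $r=0$). *)

theory Defs
  imports
    "Jordan_Normal_Form.Determinant"
    "Jordan_Normal_Form.DL_Submatrix"
    "HOL-Library.Disjoint_Sets"
    "HOL-Library.FuncSet"
begin

definition perfect_field :: "'k::field itself \<Rightarrow> bool" where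
  "perfect_field _ \<longleftrightarrow> CHAR('k) = 0 \<or> (\<forall>x::'k. \<exists>y. x = y ^ CHAR('k))"

text \<open>
  Matrices in \<^theory>\<open>Jordan_Normal_Form.Matrix\<close> are indexed from \<open>0\<close>, so the set of row and
  column indices \<open>{1,\<dots>,d}\<close> is rendered as \<open>{0..<d}\<close> throughout, the index \<open>i\<close> standing for
  \<open>Suc i\<close>. The matrices \<open>M\<^sub>1,\<dots>,M\<^sub>n\<close> themselves, and the blocks of an ordered
  partition, are numbered by \<open>{1..n}\<close>.
\<close>

text \<open>
  The extensional function space gives every ordered tuple exactly one representing function.
\<close>

definition ordered_partitions :: "nat \<Rightarrow> nat \<Rightarrow> (nat \<Rightarrow> nat set) set" where
  "ordered_partitions n d =
     {I \<in> {1..n} \<rightarrow>\<^sub>E Pow {0..<d}.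
        disjoint_family_on I {1..n} \<and> (\<Union>k\<in>{1..n}. I k) = {0..<d}}"

definition shuffle_perms :: "nat \<Rightarrow> nat \<Rightarrow> (nat \<Rightarrow> nat set) \<Rightarrow> (nat \<Rightarrow> nat) set" where
  "shuffle_perms n d I =
     {\<sigma>. \<sigma> permutes {0..<d} \<and> (\<forall>k\<in>{1..n}. strict_mono_on (I k) \<sigma>)}"

definition minor :: "nat set \<Rightarrow> nat set \<Rightarrow> 'r::comm_ring_1 mat \<Rightarrow> 'r" where
  "minor I J M = det (submatrix M I J)"

end

theory Submission
  imports Defs
begin

text \<open>
  Expanding the Leibniz formula for the sum over the choice, for each row, of the summand that
  supplies its entry turns the determinant into a sum over ordered partitions \<open>I\<close> of the rows and
  permutations \<open>\<sigma>\<close>. For fixed \<open>I\<close>, write \<open>\<sigma> = \<tau> \<circ> \<rho>\<close> with \<open>\<tau>\<close> a shuffle and \<open>\<rho>\<close> in the Young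
  subgroup preserving the blocks; summing over \<open>\<rho>\<close> gives the product of the Leibniz formulas of
  the minors. For two summands a shuffle amounts to a pair of sets \<open>I\<close>, \<open>J = \<tau> ` I\<close> of equal size,
  and its sign is the parity of the sum of all indices in \<open>I\<close> and \<open>J\<close>.
\<close>

section \<open>Increasing maps between finite sets of naturals\<close>

text \<open>An increasing map preserves rank: the elements of the image below \<open>f i\<close> are
  exactly the images of the elements of \<open>A\<close> below \<open>i\<close>. Since
  \<open>pick\<close> returns the element of a given rank, \<open>f\<close> is determined by its
  image.\<close>

lemma strict_mono_on_eq_pick:
  fixes f :: "nat \<Rightarrow> nat"
  assumes "strict_mono_on A f" and "i \<in> A"
  shows "f i = pick (f ` A) (card {a \<in> A. a < i})"
proof -
  have "{b \<in> f ` A. b < f i} = f ` {a \<in> A. a < i}"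
    using assms by (auto simp: strict_mono_on_less)
  moreover have "inj_on f {a \<in> A. a < i}"
    using strict_mono_on_imp_inj_on[OF assms(1)] by (rule inj_on_subset) auto
  ultimately have "card {b \<in> f ` A. b < f i} = card {a \<in> A. a < i}"
    by (simp add: card_image)
  then show ?thesis
    using pick_card_in_set[of "f i" "f ` A"] assms(2) by simp
qed

lemma strict_mono_on_image_unique:
  fixes f g :: "nat \<Rightarrow> nat"
  assumes "strict_mono_on A f" "strict_mono_on A g" "f ` A = g ` A" "i \<in> A"
  shows "f i = g i"
  using strict_mono_on_eq_pick[OF assms(1,4)] strict_mono_on_eq_pick[OF assms(2,4)] assms(3)
  by simp

text \<open>The increasing enumeration takes \<open>card A\<close> distinct values, all in
  \<open>A\<close>, so it exhausts \<open>A\<close>. It translates between positions in a submatrix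
  and the original indices.\<close>

lemma bij_betw_pick:
  assumes "finite A"
  shows "bij_betw (pick A) {0..<card A} A"
proof -
  have inj: "inj_on (pick A) {0..<card A}"
    by (intro inj_onI) (metis atLeastLessThan_iff card_pick_le)
  have "pick A ` {0..<card A} \<subseteq> A"
    using pick_in_set_le by auto
  then have "pick A ` {0..<card A} = A"
    by (rule card_subset_eq[OF assms]) (simp add: card_image[OF inj])
  with inj show ?thesis by (simp add: bij_betw_def)
qed

text \<open>The witness sends the element of rank r in \<open>A\<close> to the element of rank r in
  \<open>B\<close>. It is injective into a set of the same size, hence onto.\<close>

lemma ex_strict_mono_on_image:
  fixes A B :: "nat set"
  assumes "finite A" "finite B" "card A = card B"
  obtains f where "strict_mono_on A f" "f ` A = B"
proof
  let ?f = "\<lambda>i. pick B (card {a \<in> A. a < i})"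
  have less: "card {a \<in> A. a < i} < card B" if "i \<in> A" for i
  proof -
    have "{a \<in> A. a < i} \<subset> A" using that by auto
    then show ?thesis using assms by (metis psubset_card_mono)
  qed
  show mono: "strict_mono_on A ?f"
  proof (rule strict_mono_onI)
    fix i j assume "i \<in> A" "j \<in> A" "i < j"
    then have "{a \<in> A. a < i} \<subset> {a \<in> A. a < j}" by auto
    then have "card {a \<in> A. a < i} < card {a \<in> A. a < j}"
      using assms(1) by (simp add: psubset_card_mono)
    then show "?f i < ?f j"
      using less[OF \<open>j \<in> A\<close>] by (rule pick_mono_le[rotated])
  qed
  have "?f ` A \<subseteq> B"
    using less pick_in_set_le by auto
  then show "?f ` A = B"
    by (rule card_subset_eq[OF assms(2)])
      (simp add: card_image[OF strict_mono_on_imp_inj_on[OF mono]] assms(3))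
qed

text \<open>Increasing bijections between corresponding blocks are glued together. This is the
  source of all shuffles: prescribing the images of the blocks, with the right sizes, is enough to
  obtain one.\<close>

lemma ex_blockwise_strict_mono_permutation:
  fixes I J :: "'k \<Rightarrow> nat set"
  assumes "finite S"
    and disj: "disjoint_family_on I K" "disjoint_family_on J K"
    and un: "(\<Union>k\<in>K. I k) = S" "(\<Union>k\<in>K. J k) = S"
    and card: "\<And>k. k \<in> K \<Longrightarrow> card (I k) = card (J k)"
  obtains \<tau> where "\<tau> permutes S" "\<And>k. k \<in> K \<Longrightarrow> strict_mono_on (I k) \<tau>"
    "\<And>k. k \<in> K \<Longrightarrow> \<tau> ` I k = J k"
proof -
  have "\<forall>k\<in>K. \<exists>f. strict_mono_on (I k) f \<and> f ` I k = J k"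
  proof
    fix k assume "k \<in> K"
    then have "finite (I k)" "finite (J k)"
      using un assms(1) by (auto intro: finite_subset)
    from ex_strict_mono_on_image[OF this card[OF \<open>k \<in> K\<close>]]
    show "\<exists>f. strict_mono_on (I k) f \<and> f ` I k = J k" by blast
  qed
  then obtain f where f: "\<And>k. k \<in> K \<Longrightarrow> strict_mono_on (I k) (f k)"
      "\<And>k. k \<in> K \<Longrightarrow> f k ` I k = J k"
    by metis
  \<comment> \<open>By disjointness the block containing \<open>i\<close> is unique, so
    \<open>THE\<close> is meaningful on \<open>S\<close>. Outside \<open>S\<close> the value is
    \<open>i\<close>, as \<open>permutes\<close> demands.\<close>
  define \<tau> where "\<tau> i = (if i \<in> S then f (THE k. k \<in> K \<and> i \<in> I k) i else i)" for i
  have \<tau>: "\<tau> i = f k i" if "k \<in> K" "i \<in> I k" for k i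
  proof -
    have "(THE k. k \<in> K \<and> i \<in> I k) = k"
      using that disj(1) by (auto simp: disjoint_family_on_def)
    then show ?thesis
      using that un by (auto simp: \<tau>_def)
  qed
  have mono: "strict_mono_on (I k) \<tau>" if "k \<in> K" for k
    using f(1)[OF that] \<tau>[OF that] by (auto simp: strict_mono_on_def)
  have image: "\<tau> ` I k = J k" if "k \<in> K" for k
    using f(2)[OF that] \<tau>[OF that] by (auto simp: image_iff)
  have "bij_betw \<tau> (\<Union>k\<in>K. I k) (\<Union>k\<in>K. J k)"
    using mono image
    by (intro bij_betw_UNION_disjoint disj(2)) (auto simp: bij_betw_def strict_mono_on_imp_inj_on)
  then have "\<tau> permutes S"
    unfolding un by (rule bij_imp_permutes) (simp add: \<tau>_def)
  then show ?thesis using mono image that by blast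
qed

section \<open>Leibniz formulas for minors and for products of minors\<close>

text \<open>As \<tau> is increasing on \<open>I\<close>, it maps the b-th row index to the b-th
  column index. Conjugating by \<open>pick I\<close> then turns the permutations of positions in the
  Leibniz formula into permutations of \<open>I\<close> itself, with the same signs.\<close>

lemma minor_strict_mono_image:
  fixes M :: "'r::comm_ring_1 mat"
  assumes M: "M \<in> carrier_mat d d" and I: "I \<subseteq> {0..<d}" and \<tau>I: "\<tau> ` I \<subseteq> {0..<d}"
    and mono: "strict_mono_on I \<tau>"
  shows "minor I (\<tau> ` I) M =
    (\<Sum>\<rho> | \<rho> permutes I. of_int (sign \<rho>) * (\<Prod>i\<in>I. M $$ (i, \<tau> (\<rho> i))))"
proof -
  define r where "r = card I"
  have fin: "finite I" using I finite_subset by blast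
  have bij: "bij_betw (pick I) {0..<r} I"
    unfolding r_def by (rule bij_betw_pick[OF fin])
  have rows: "{i. i < dim_row M \<and> i \<in> I} = I" and cols: "{j. j < dim_col M \<and> j \<in> \<tau> ` I} = \<tau> ` I"
    using M I \<tau>I by auto
  have card_\<tau>: "card (\<tau> ` I) = r"
    unfolding r_def by (rule card_image[OF strict_mono_on_imp_inj_on[OF mono]])
  have pick_\<tau>: "pick (\<tau> ` I) a = \<tau> (pick I a)" if "a < r" for a
  proof -
    have "pick I a \<in> I" and "card {x \<in> I. x < pick I a} = a"
      using that by (simp_all add: r_def pick_in_set_le card_pick_le)
    then show ?thesis using strict_mono_on_eq_pick[OF mono] by simp
  qed
  let ?N = "submatrix M I (\<tau> ` I)"
  have N: "?N \<in> carrier_mat r r"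
    by (rule carrier_matI) (simp_all add: dim_submatrix rows cols card_\<tau>, simp add: r_def)
  have entry: "?N $$ (a, b) = M $$ (pick I a, \<tau> (pick I b))" if "a < r" "b < r" for a b
    using that by (subst submatrix_index) (simp_all add: rows cols card_\<tau> pick_\<tau> flip: r_def)
  \<comment> \<open>\<open>?F\<close> is conjugation by \<open>pick I\<close>, extended by the
    identity outside \<open>I\<close>. In this form it is the known bijection between permutations
    of positions and permutations of \<open>I\<close>; written as \<open>map_permutation\<close> it
    has a known sign.\<close>
  let ?F = "\<lambda>\<pi> x. if x \<in> I then pick I (\<pi> (inv_into {0..<r} (pick I) x)) else x"
  have F: "?F \<pi> = map_permutation {0..<r} (pick I) \<pi>" for \<pi>
    using bij by (auto simp: map_permutation_def restrict_id_def bij_betw_def fun_eq_iff)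
  have "minor I (\<tau> ` I) M = (\<Sum>\<pi> | \<pi> permutes {0..<r}. of_int (sign \<pi>) *
      (\<Prod>a = 0..<r. M $$ (pick I a, \<tau> (pick I (\<pi> a)))))"
    unfolding minor_def det_def'[OF N]
    by (intro sum.cong refl arg_cong2[where f = "(*)"] prod.cong)
      (auto simp: entry permutes_nat_less)
  also have "\<dots> = (\<Sum>\<pi> | \<pi> permutes {0..<r}. of_int (sign (?F \<pi>)) *
      (\<Prod>i\<in>I. M $$ (i, \<tau> (?F \<pi> i))))"
  proof (intro sum.cong refl arg_cong2[where f = "(*)"])
    fix \<pi> assume "\<pi> \<in> {\<pi>. \<pi> permutes {0..<r}}"
    then have "sign (?F \<pi>) = sign \<pi>"
      unfolding F by (intro sign_map_permutation) (use bij in \<open>auto simp: bij_betw_def\<close>)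
    then show "of_int (sign \<pi>) = (of_int (sign (?F \<pi>)) :: 'r)" by simp
    show "(\<Prod>a = 0..<r. M $$ (pick I a, \<tau> (pick I (\<pi> a)))) =
        (\<Prod>i\<in>I. M $$ (i, \<tau> (?F \<pi> i)))"
      by (subst prod.reindex_bij_betw[OF bij, symmetric], rule prod.cong)
        (use bij in \<open>auto simp: bij_betw_def\<close>)
  qed
  also have "\<dots> = (\<Sum>\<rho> | \<rho> permutes I. of_int (sign \<rho>) * (\<Prod>i\<in>I. M $$ (i, \<tau> (\<rho> i))))"
    by (rule sum.reindex_bij_betw[OF bij_betw_permutations[OF bij]])
  finally show ?thesis .
qed

text \<open>The Young subgroup preserving each block is the direct product of the symmetric groups
  of the blocks, and the sign is multiplicative. Multiplying out the product therefore yields one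
  sum over that subgroup. The induction splits off one block at a time.\<close>

lemma prod_sum_permutes_blocks:
  fixes g :: "'k \<Rightarrow> 'a \<Rightarrow> 'a \<Rightarrow> 'r::comm_ring_1"
  assumes "finite K" "disjoint_family_on I K" "\<And>k. k \<in> K \<Longrightarrow> finite (I k)"
  shows "(\<Prod>k\<in>K. \<Sum>\<rho> | \<rho> permutes I k. of_int (sign \<rho>) * (\<Prod>i\<in>I k. g k i (\<rho> i))) =
    (\<Sum>\<rho> | \<rho> permutes (\<Union>k\<in>K. I k) \<and> (\<forall>k\<in>K. \<rho> ` I k = I k).
      of_int (sign \<rho>) * (\<Prod>k\<in>K. \<Prod>i\<in>I k. g k i (\<rho> i)))"
  using assms
proof (induction K rule: finite_induct)
  case empty
  have "{\<rho> :: 'a \<Rightarrow> 'a. \<rho> permutes {}} = {id}" by auto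
  then show ?case by simp
next
  case (insert x K)
  let ?A = "I x" and ?B = "\<Union>k\<in>K. I k"
  let ?P = "{p. p permutes ?A}"
  let ?Q = "{q. q permutes ?B \<and> (\<forall>k\<in>K. q ` I k = I k)}"
  let ?R = "{\<rho>. \<rho> permutes (\<Union>k\<in>insert x K. I k) \<and> (\<forall>k\<in>insert x K. \<rho> ` I k = I k)}"
  let ?h = "\<lambda>L \<rho>. of_int (sign \<rho>) * (\<Prod>k\<in>L. \<Prod>i\<in>I k. g k i (\<rho> i))"
  have disj: "?A \<inter> ?B = {}" and disj_K: "disjoint_family_on I K"
    using insert.prems(1) insert.hyps(2) by (auto simp: disjoint_family_on_def)
  have fin: "finite ?A" "finite ?B" using insert by auto
  \<comment> \<open>The supports of \<open>p\<close> and \<open>q\<close> are disjoint, so on each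
    of the two sets the composite acts through one factor only.\<close>
  have on_A: "(p \<circ> q) i = p i" if "p permutes ?A" "q permutes ?B" "i \<in> ?A" for p q i
  proof -
    have "i \<notin> ?B" using that(3) disj by blast
    then show ?thesis using permutes_not_in[OF that(2)] by simp
  qed
  have on_B: "(p \<circ> q) i = q i" if "p permutes ?A" "q permutes ?B" "i \<in> ?B" for p q i
  proof -
    have "q i \<notin> ?A" using permutes_in_image[OF that(2)] that(3) disj by blast
    then show ?thesis using permutes_not_in[OF that(1)] by simp
  qed
  have "(\<Prod>k\<in>insert x K. \<Sum>\<rho> | \<rho> permutes I k. of_int (sign \<rho>) * (\<Prod>i\<in>I k. g k i (\<rho> i))) =
      (\<Sum>p\<in>?P. of_int (sign p) * (\<Prod>i\<in>?A. g x i (p i))) * (\<Sum>q\<in>?Q. ?h K q)"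
    using insert disj_K by simp
  also have "\<dots> = (\<Sum>(p, q)\<in>?P \<times> ?Q. (of_int (sign p) * (\<Prod>i\<in>?A. g x i (p i))) * ?h K q)"
    by (simp add: sum_product sum.cartesian_product)
  also have "\<dots> = (\<Sum>\<rho>\<in>?R. ?h (insert x K) \<rho>)"
  \<comment> \<open>A permutation preserving the new block and each old one is recovered from its
    restrictions to the new block and to the union of the old ones.\<close>
  proof (rule sum.reindex_bij_witness[where j = "\<lambda>(p, q). p \<circ> q"
        and i = "\<lambda>\<rho>. (restrict_id \<rho> ?A, restrict_id \<rho> ?B)"])
    fix pq assume "pq \<in> ?P \<times> ?Q"
    then obtain p q where pq: "pq = (p, q)" and p: "p permutes ?A" and q: "q permutes ?B"
      and q_blocks: "\<And>k. k \<in> K \<Longrightarrow> q ` I k = I k"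
      by auto
    show "(restrict_id (case pq of (p, q) \<Rightarrow> p \<circ> q) ?A,
        restrict_id (case pq of (p, q) \<Rightarrow> p \<circ> q) ?B) = pq"
      using on_A[OF p q] on_B[OF p q] permutes_not_in[OF p] permutes_not_in[OF q]
      unfolding pq restrict_id_def by (auto simp: fun_eq_iff)
    have "p \<circ> q permutes ?A \<union> ?B"
      using p q by (intro permutes_compose) (auto intro: permutes_subset)
    moreover have "(p \<circ> q) ` ?A = ?A"
      using on_A[OF p q] permutes_image[OF p] by (simp cong: image_cong)
    moreover have "(p \<circ> q) ` I k = I k" if "k \<in> K" for k
    proof -
      have "(p \<circ> q) ` I k = q ` I k"
        using on_B[OF p q] that by (intro image_cong) auto
      then show ?thesis using q_blocks[OF that] by simp
    qed
    ultimately show "(case pq of (p, q) \<Rightarrow> p \<circ> q) \<in> ?R"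
      unfolding pq by simp
    have "sign (p \<circ> q) = sign p * sign q"
      using p q fin by (intro sign_compose) (auto intro: permutes_imp_permutation)
    moreover have "(\<Prod>i\<in>?A. g x i ((p \<circ> q) i)) = (\<Prod>i\<in>?A. g x i (p i))"
      using on_A[OF p q] by (intro prod.cong) auto
    moreover have "(\<Prod>k\<in>K. \<Prod>i\<in>I k. g k i ((p \<circ> q) i)) = (\<Prod>k\<in>K. \<Prod>i\<in>I k. g k i (q i))"
    proof (intro prod.cong refl)
      fix k i assume "k \<in> K" "i \<in> I k"
      then have "(p \<circ> q) i = q i" using on_B[OF p q, of i] by blast
      then show "g k i ((p \<circ> q) i) = g k i (q i)" by simp
    qed
    ultimately show "?h (insert x K) (case pq of (p, q) \<Rightarrow> p \<circ> q) =
        (case pq of (p, q) \<Rightarrow> (of_int (sign p) * (\<Prod>i\<in>?A. g x i (p i))) * ?h K q)"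
      unfolding pq using insert.hyps by (simp add: mult_ac del: comp_apply)
  next
    fix \<rho> assume "\<rho> \<in> ?R"
    then have \<rho>: "\<rho> permutes ?A \<union> ?B" and im_A: "\<rho> ` ?A = ?A"
      and im_K: "\<And>k. k \<in> K \<Longrightarrow> \<rho> ` I k = I k"
      by auto
    have im_B: "\<rho> ` ?B = ?B" using im_K by (simp add: image_UN)
    have in_A: "\<rho> i \<in> ?A" if "i \<in> ?A" for i using im_A that by blast
    have in_B: "\<rho> i \<in> ?B" if "i \<in> ?B" for i using im_B that by blast
    have "restrict_id \<rho> ?A permutes ?A" "restrict_id \<rho> ?B permutes ?B"
      using im_A im_B permutes_inj_on[OF \<rho>]
      by (auto intro!: permutes_restrict_id simp: bij_betw_def)
    moreover have "restrict_id \<rho> ?B ` I k = I k" if "k \<in> K" for k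
    proof -
      have "restrict_id \<rho> ?B ` I k = \<rho> ` I k"
        using that by (intro image_cong) (auto simp: restrict_id_def)
      then show ?thesis using im_K[OF that] by simp
    qed
    ultimately show "(restrict_id \<rho> ?A, restrict_id \<rho> ?B) \<in> ?P \<times> ?Q" by simp
    show "(case (restrict_id \<rho> ?A, restrict_id \<rho> ?B) of (p, q) \<Rightarrow> p \<circ> q) = \<rho>"
    proof
      fix i
      consider "i \<in> ?A" | "i \<in> ?B" | "i \<notin> ?A \<union> ?B" by blast
      then show "(case (restrict_id \<rho> ?A, restrict_id \<rho> ?B) of (p, q) \<Rightarrow> p \<circ> q) i = \<rho> i"
      proof cases
        case 1
        then have "i \<notin> ?B" using disj by blast
        then show ?thesis using 1 by (simp add: restrict_id_def)
      next
        case 2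
        then have "\<rho> i \<notin> ?A" using in_B disj by blast
        then show ?thesis using 2 by (simp add: restrict_id_def)
      next
        case 3
        then show ?thesis using permutes_not_in[OF \<rho> 3] by (simp add: restrict_id_def)
      qed
    qed
  qed
  finally show ?case .
qed

section \<open>Factoring permutations into shuffles and block permutations\<close>

lemma ordered_partitionsD:
  assumes "I \<in> ordered_partitions n d"
  shows "disjoint_family_on I {1..n}" "(\<Union>k\<in>{1..n}. I k) = {0..<d}"
    and "\<And>k. k \<in> {1..n} \<Longrightarrow> I k \<subseteq> {0..<d}"
  using assms by (auto simp: ordered_partitions_def)

text \<open>
  The shuffle factor \<open>\<tau>\<close> is recovered from \<open>\<tau> \<circ> \<rho>\<close> through the images of the blocks,
  which \<open>\<rho>\<close> does not change.
\<close>
lemma bij_betw_shuffle_comp_block_permutation: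
  assumes I: "I \<in> ordered_partitions n d"
  shows "bij_betw (\<lambda>(\<tau>, \<rho>). \<tau> \<circ> \<rho>)
    (shuffle_perms n d I \<times> {\<rho>. \<rho> permutes {0..<d} \<and> (\<forall>k\<in>{1..n}. \<rho> ` I k = I k)})
    {\<sigma>. \<sigma> permutes {0..<d}}" (is "bij_betw ?c (?T \<times> ?Y) ?S")
proof -
  note disj = ordered_partitionsD(1)[OF I] and un = ordered_partitionsD(2)[OF I]
  have "inj_on ?c (?T \<times> ?Y)"
  proof (rule inj_onI, clarify)
    fix \<tau> \<rho> \<tau>' \<rho>'
    assume \<tau>: "\<tau> \<in> ?T" and \<tau>': "\<tau>' \<in> ?T" and \<rho>: "\<rho> permutes {0..<d}" "\<forall>k\<in>{1..n}. \<rho> ` I k = I k"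
      and \<rho>': "\<rho>' permutes {0..<d}" "\<forall>k\<in>{1..n}. \<rho>' ` I k = I k" and eq: "\<tau> \<circ> \<rho> = \<tau>' \<circ> \<rho>'"
    have "\<tau> i = \<tau>' i" for i
    proof (cases "i \<in> {0..<d}")
      case True
      then obtain k where k: "k \<in> {1..n}" "i \<in> I k" using un by blast
      have "\<tau> ` I k = (\<tau> \<circ> \<rho>) ` I k" "\<tau>' ` I k = (\<tau>' \<circ> \<rho>') ` I k"
        using \<rho>(2) \<rho>'(2) k(1) by (metis image_comp)+
      then have "\<tau> ` I k = \<tau>' ` I k" using eq by simp
      with \<tau> \<tau>' k show ?thesis
        by (intro strict_mono_on_image_unique[of "I k"]) (auto simp: shuffle_perms_def)
    next
      case False
      then show ?thesis using \<tau> \<tau>' by (simp add: shuffle_perms_def permutes_def)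
    qed
    then have \<tau>\<tau>': "\<tau> = \<tau>'" by blast
    moreover have "inj \<tau>'" using \<tau>' by (auto simp: shuffle_perms_def permutes_inj)
    ultimately have "\<rho> = \<rho>'" using eq by (simp add: fun_eq_iff inj_eq)
    with \<tau>\<tau>' show "\<tau> = \<tau>' \<and> \<rho> = \<rho>'" by simp
  qed
  moreover have "?c ` (?T \<times> ?Y) = ?S"
  proof
    show "?c ` (?T \<times> ?Y) \<subseteq> ?S"
      by (auto simp: shuffle_perms_def intro: permutes_compose)
    show "?S \<subseteq> ?c ` (?T \<times> ?Y)"
    proof
      fix \<sigma> assume "\<sigma> \<in> ?S"
      then have \<sigma>: "\<sigma> permutes {0..<d}" by simp
      have inj: "inj \<sigma>" by (rule permutes_inj[OF \<sigma>])
      \<comment> \<open>The images of the blocks under \<sigma> form a partition with the same block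
        sizes. The shuffle with these block images is the required \<tau>, and the inverse of \<tau>
        followed after \<sigma> then preserves every block.\<close>
      have "disjoint_family_on (\<lambda>k. \<sigma> ` I k) {1..n}"
        using disj inj unfolding disjoint_family_on_def by (metis image_Int image_empty)
      moreover have "(\<Union>k\<in>{1..n}. \<sigma> ` I k) = {0..<d}"
        using permutes_image[OF \<sigma>] un by (metis image_UN)
      moreover have "card (I k) = card (\<sigma> ` I k)" for k
        using inj by (metis card_image inj_on_subset subset_UNIV)
      ultimately obtain \<tau> where \<tau>: "\<tau> permutes {0..<d}"
          "\<And>k. k \<in> {1..n} \<Longrightarrow> strict_mono_on (I k) \<tau>"
          "\<And>k. k \<in> {1..n} \<Longrightarrow> \<tau> ` I k = \<sigma> ` I k"
        using ex_blockwise_strict_mono_permutation[OF finite_atLeastLessThan disj _ un,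
            of "\<lambda>k. \<sigma> ` I k"]
        by metis
      have "(Hilbert_Choice.inv \<tau> \<circ> \<sigma>) ` I k = I k" if "k \<in> {1..n}" for k
        using \<tau>(3)[OF that] permutes_inj[OF \<tau>(1)] by (metis image_comp image_inv_f_f)
      moreover have "Hilbert_Choice.inv \<tau> \<circ> \<sigma> permutes {0..<d}"
        using \<sigma> \<tau>(1) by (intro permutes_compose permutes_inv)
      moreover have "\<tau> \<circ> (Hilbert_Choice.inv \<tau> \<circ> \<sigma>) = \<sigma>"
        using permutes_inverses[OF \<tau>(1)] by auto
      ultimately show "\<sigma> \<in> ?c ` (?T \<times> ?Y)"
        using \<tau> by (intro image_eqI[of _ _ "(\<tau>, Hilbert_Choice.inv \<tau> \<circ> \<sigma>)"]) (auto simp: shuffle_perms_def)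
    qed
  qed
  ultimately show ?thesis by (simp add: bij_betw_def)
qed

text \<open>The permutations are grouped by their shuffle factor \<tau>. Within a group the
  remaining sum over block permutations is the product of the Leibniz sums of the minors with
  columns taken from the images of the blocks under \<tau>.\<close>

lemma sum_permutations_eq_sum_shuffles:
  fixes M :: "nat \<Rightarrow> 'r::comm_ring_1 mat"
  assumes M: "\<And>k. k \<in> {1..n} \<Longrightarrow> M k \<in> carrier_mat d d"
    and I: "I \<in> ordered_partitions n d"
  shows "(\<Sum>\<sigma> | \<sigma> permutes {0..<d}. of_int (sign \<sigma>) * (\<Prod>k\<in>{1..n}. \<Prod>i\<in>I k. M k $$ (i, \<sigma> i))) =
    (\<Sum>\<tau>\<in>shuffle_perms n d I. of_int (sign \<tau>) * (\<Prod>k\<in>{1..n}. minor (I k) (\<tau> ` I k) (M k)))"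
proof -
  let ?Y = "{\<rho>. \<rho> permutes {0..<d} \<and> (\<forall>k\<in>{1..n}. \<rho> ` I k = I k)}"
  let ?h = "\<lambda>\<sigma>. of_int (sign \<sigma>) * (\<Prod>k\<in>{1..n}. \<Prod>i\<in>I k. M k $$ (i, \<sigma> i))"
  note disj = ordered_partitionsD(1)[OF I] and un = ordered_partitionsD(2)[OF I]
    and sub = ordered_partitionsD(3)[OF I]
  have "(\<Sum>\<sigma> | \<sigma> permutes {0..<d}. ?h \<sigma>) =
      (\<Sum>x\<in>shuffle_perms n d I \<times> ?Y. ?h (case x of (\<tau>, \<rho>) \<Rightarrow> \<tau> \<circ> \<rho>))"
    by (rule sum.reindex_bij_betw[OF bij_betw_shuffle_comp_block_permutation[OF I], symmetric])
  also have "\<dots> = (\<Sum>\<tau>\<in>shuffle_perms n d I. \<Sum>\<rho>\<in>?Y. ?h (\<tau> \<circ> \<rho>))"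
    by (simp add: sum.cartesian_product split_def)
  also have "\<dots> = (\<Sum>\<tau>\<in>shuffle_perms n d I. of_int (sign \<tau>) *
      (\<Prod>k\<in>{1..n}. minor (I k) (\<tau> ` I k) (M k)))"
  proof (rule sum.cong[OF refl])
    fix \<tau> assume "\<tau> \<in> shuffle_perms n d I"
    then have \<tau>: "\<tau> permutes {0..<d}" and mono: "\<And>k. k \<in> {1..n} \<Longrightarrow> strict_mono_on (I k) \<tau>"
      by (auto simp: shuffle_perms_def)
    have "minor (I k) (\<tau> ` I k) (M k) = (\<Sum>\<rho> | \<rho> permutes I k. of_int (sign \<rho>) *
        (\<Prod>i\<in>I k. M k $$ (i, \<tau> (\<rho> i))))" if k: "k \<in> {1..n}" for k
    proof (rule minor_strict_mono_image[OF M[OF k] sub[OF k] _ mono[OF k]])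
      show "\<tau> ` I k \<subseteq> {0..<d}"
        using image_mono[OF sub[OF k], of \<tau>] permutes_image[OF \<tau>] by simp
    qed
    then have "(\<Prod>k\<in>{1..n}. minor (I k) (\<tau> ` I k) (M k)) = (\<Prod>k\<in>{1..n}. \<Sum>\<rho> | \<rho> permutes I k.
        of_int (sign \<rho>) * (\<Prod>i\<in>I k. M k $$ (i, \<tau> (\<rho> i))))"
      by (intro prod.cong) auto
    also have "\<dots> = (\<Sum>\<rho>\<in>?Y. of_int (sign \<rho>) *
        (\<Prod>k\<in>{1..n}. \<Prod>i\<in>I k. M k $$ (i, \<tau> (\<rho> i))))"
      by (subst prod_sum_permutes_blocks[OF _ disj, unfolded un])
        (auto intro: finite_subset[OF sub])
    finally have *: "(\<Prod>k\<in>{1..n}. minor (I k) (\<tau> ` I k) (M k)) = \<dots>" .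
    have "sign (\<tau> \<circ> \<rho>) = sign \<tau> * sign \<rho>" if "\<rho> \<in> ?Y" for \<rho>
      using that \<tau> by (intro sign_compose) (auto intro: permutes_imp_permutation)
    then show "(\<Sum>\<rho>\<in>?Y. ?h (\<tau> \<circ> \<rho>)) =
        of_int (sign \<tau>) * (\<Prod>k\<in>{1..n}. minor (I k) (\<tau> ` I k) (M k))"
      unfolding * sum_distrib_left by (intro sum.cong) (auto simp: mult.assoc)
  qed
  finally show ?thesis .
qed

section \<open>Expanding the determinant of a sum of matrices\<close>

text \<open>The sum is formed in the additive group of matrices of one fixed size, so that the empty
  sum is the zero matrix of that size. Entries are then read off by induction on the index
  set.\<close>

lemma index_finsum_mat:
  fixes M :: "'k \<Rightarrow> 'r::comm_ring_1 mat"
  assumes "finite K" "\<And>k. k \<in> K \<Longrightarrow> M k \<in> carrier_mat m n"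
  shows "finsum (module_mat TYPE('r) m n) M K \<in> carrier_mat m n"
    and "\<And>i j. i < m \<Longrightarrow> j < n \<Longrightarrow> finsum (module_mat TYPE('r) m n) M K $$ (i, j) = (\<Sum>k\<in>K. M k $$ (i, j))"
proof -
  interpret abelian_group "module_mat TYPE('r) m n" by (rule abelian_group_mat)
  have "finsum (module_mat TYPE('r) m n) M K \<in> carrier_mat m n \<and>
    (\<forall>i<m. \<forall>j<n. finsum (module_mat TYPE('r) m n) M K $$ (i, j) = (\<Sum>k\<in>K. M k $$ (i, j)))"
    using assms
  proof (induction K rule: finite_induct)
    case empty
    then show ?case by (simp add: module_mat_simps)
  next
    case (insert k K)
    then have "finsum (module_mat TYPE('r) m n) M (insert k K) =
        M k + finsum (module_mat TYPE('r) m n) M K"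
      by (subst finsum_insert) (auto simp: module_mat_simps)
    with insert show ?case by auto
  qed
  then show "finsum (module_mat TYPE('r) m n) M K \<in> carrier_mat m n"
    and "\<And>i j. i < m \<Longrightarrow> j < n \<Longrightarrow> finsum (module_mat TYPE('r) m n) M K $$ (i, j) = (\<Sum>k\<in>K. M k $$ (i, j))"
    by auto
qed

text \<open>Multiplying out selects one summand for each row. Such a choice function corresponds to
  the ordered partition of the rows into its fibres, some of which may be empty.\<close>

lemma prod_sum_ordered_partitions:
  fixes g :: "nat \<Rightarrow> nat \<Rightarrow> 'r::comm_semiring_1"
  shows "(\<Prod>i = 0..<d. \<Sum>k\<in>{1..n}. g k i) =
    (\<Sum>I\<in>ordered_partitions n d. \<Prod>k\<in>{1..n}. \<Prod>i\<in>I k. g k i)"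
proof -
  let ?block = "\<lambda>I i. THE k. k \<in> {1..n} \<and> i \<in> I k"
  have block: "?block I i = k" if "I \<in> ordered_partitions n d" "k \<in> {1..n}" "i \<in> I k" for I i k
    using ordered_partitionsD(1)[OF that(1)] that(2,3) unfolding disjoint_family_on_def
    by (intro the_equality) blast+
  have block_in: "?block I i \<in> {1..n}" "i \<in> I (?block I i)"
    if I: "I \<in> ordered_partitions n d" and i: "i \<in> {0..<d}" for I i
  proof -
    obtain k where "k \<in> {1..n}" "i \<in> I k"
      using ordered_partitionsD(2)[OF I] i by blast
    then show "?block I i \<in> {1..n}" "i \<in> I (?block I i)" using block[OF I] by simp_all
  qed
  have "(\<Prod>i = 0..<d. \<Sum>k\<in>{1..n}. g k i) = (\<Sum>f\<in>{0..<d} \<rightarrow>\<^sub>E {1..n}. \<Prod>i = 0..<d. g (f i) i)"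
    by (rule prod_sum_PiE) auto
  also have "\<dots> = (\<Sum>I\<in>ordered_partitions n d. \<Prod>k\<in>{1..n}. \<Prod>i\<in>I k. g k i)"
  \<comment> \<open>Both directions use restricted functions: choice functions and tuples of blocks
    are extensional, with value \<open>undefined\<close> outside their index sets, and this makes
    the correspondence exact.\<close>
  proof (rule sum.reindex_bij_witness[where i = "\<lambda>I. \<lambda>i\<in>{0..<d}. ?block I i"
        and j = "\<lambda>f. \<lambda>k\<in>{1..n}. {i \<in> {0..<d}. f i = k}"])
    fix f assume f: "f \<in> {0..<d} \<rightarrow>\<^sub>E {1..n}"
    let ?I = "\<lambda>k\<in>{1..n}. {i \<in> {0..<d}. f i = k}"
    show I: "?I \<in> ordered_partitions n d"
      using f by (auto simp: ordered_partitions_def disjoint_family_on_def)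
    show "(\<lambda>i\<in>{0..<d}. ?block ?I i) = f"
    proof
      fix i
      show "(\<lambda>i\<in>{0..<d}. ?block ?I i) i = f i"
      proof (cases "i \<in> {0..<d}")
        case True
        then have "f i \<in> {1..n}" using f by blast
        with True show ?thesis using block[OF I, of "f i" i] by simp
      next
        case False
        then show ?thesis using PiE_arb[OF f False] by simp
      qed
    qed
    \<comment> \<open>On the fibre over \<open>k\<close> the index \<open>k\<close> equals
      \<open>f i\<close>, so the double product is a single product over rows grouped by
      \<open>f\<close>.\<close>
    have "(\<Prod>k\<in>{1..n}. \<Prod>i\<in>?I k. g k i) = (\<Prod>k\<in>{1..n}. \<Prod>i | i \<in> {0..<d} \<and> f i = k. g (f i) i)"
      by (intro prod.cong) auto
    also have "\<dots> = (\<Prod>i = 0..<d. g (f i) i)"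
      using f by (intro prod.group) auto
    finally show "(\<Prod>k\<in>{1..n}. \<Prod>i\<in>?I k. g k i) = (\<Prod>i = 0..<d. g (f i) i)" .
  next
    fix I assume I: "I \<in> ordered_partitions n d"
    show "(\<lambda>i\<in>{0..<d}. ?block I i) \<in> {0..<d} \<rightarrow>\<^sub>E {1..n}"
      using block_in(1)[OF I] by auto
    show "(\<lambda>k\<in>{1..n}. {i \<in> {0..<d}. (\<lambda>i\<in>{0..<d}. ?block I i) i = k}) = I"
    proof
      fix k
      show "(\<lambda>k\<in>{1..n}. {i \<in> {0..<d}. (\<lambda>i\<in>{0..<d}. ?block I i) i = k}) k = I k"
      proof (cases "k \<in> {1..n}")
        case True
        have "i \<in> I k \<longleftrightarrow> i \<in> {0..<d} \<and> ?block I i = k" for i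
          using block[OF I True] block_in(2)[OF I] ordered_partitionsD(3)[OF I True] by blast
        with True show ?thesis by auto
      next
        case False
        have "I \<in> {1..n} \<rightarrow>\<^sub>E Pow {0..<d}"
          using I by (simp add: ordered_partitions_def)
        from PiE_arb[OF this False] False show ?thesis by (simp only: restrict_apply if_False)
      qed
    qed
  qed
  finally show ?thesis .
qed

theorem det_finsum_mat:
  fixes M :: "nat \<Rightarrow> 'r::comm_ring_1 mat"
  assumes M: "\<And>k. k \<in> {1..n} \<Longrightarrow> M k \<in> carrier_mat d d"
  shows "det (finsum (module_mat TYPE('r) d d) M {1..n}) =
    (\<Sum>I\<in>ordered_partitions n d. \<Sum>\<sigma>\<in>shuffle_perms n d I.
      of_int (sign \<sigma>) * (\<Prod>k\<in>{1..n}. minor (I k) (\<sigma> ` I k) (M k)))"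
proof -
  let ?S = "finsum (module_mat TYPE('r) d d) M {1..n}"
  have S: "?S \<in> carrier_mat d d"
    "\<And>i j. i < d \<Longrightarrow> j < d \<Longrightarrow> ?S $$ (i, j) = (\<Sum>k\<in>{1..n}. M k $$ (i, j))"
    using M by (auto intro!: index_finsum_mat)
  have "det ?S = (\<Sum>\<sigma> | \<sigma> permutes {0..<d}. of_int (sign \<sigma>) * (\<Prod>i = 0..<d. \<Sum>k\<in>{1..n}. M k $$ (i, \<sigma> i)))"
    unfolding det_def'[OF S(1)]
    by (intro sum.cong refl arg_cong2[where f = "(*)"] prod.cong) (auto simp: S(2) simp del: One_nat_def)
  \<comment> \<open>Exchanging the two sums puts the partition outside, so that the shuffle
    factorization can be applied to each partition separately.\<close>
  also have "\<dots> = (\<Sum>I\<in>ordered_partitions n d. \<Sum>\<sigma> | \<sigma> permutes {0..<d}.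
      of_int (sign \<sigma>) * (\<Prod>k\<in>{1..n}. \<Prod>i\<in>I k. M k $$ (i, \<sigma> i)))"
    unfolding prod_sum_ordered_partitions sum_distrib_left by (rule sum.swap)
  also have "\<dots> = (\<Sum>I\<in>ordered_partitions n d. \<Sum>\<sigma>\<in>shuffle_perms n d I.
      of_int (sign \<sigma>) * (\<Prod>k\<in>{1..n}. minor (I k) (\<sigma> ` I k) (M k)))"
    by (intro sum.cong refl sum_permutations_eq_sum_shuffles M)
  finally show ?thesis .
qed

section \<open>The sign of a shuffle with two blocks\<close>

text \<open>An adjacent transposition reverses the order of a single pair, so it is increasing on
  any set that misses one member of the pair.\<close>

lemma strict_mono_on_transpose_Suc:
  assumes "m \<notin> X \<or> Suc m \<notin> X"
  shows "strict_mono_on X (Transposition.transpose m (Suc m))"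
  using assms by (auto simp: strict_mono_on_def Transposition.transpose_def)

text \<open>The swap only replaces \<open>Suc m\<close> by \<open>m\<close>. The resulting drop by
  one drives the induction for the sign of a shuffle and matches one sign change.\<close>

lemma sum_transpose_Suc_image:
  assumes "finite X" "Suc m \<in> X" "m \<notin> X"
  shows "Suc (\<Sum>(Transposition.transpose m (Suc m) ` X)) = \<Sum>X"
proof -
  have "Transposition.transpose m (Suc m) ` X = insert m (X - {Suc m})"
    using assms(2,3) by (auto simp: Transposition.transpose_def image_iff)
  then show ?thesis using assms by (simp add: sum.remove[of X "Suc m"])
qed

lemma strict_mono_on_comp:
  assumes "strict_mono_on (f ` X) g" "strict_mono_on X f"
  shows "strict_mono_on X (g \<circ> f)"
  using assms by (auto simp: strict_mono_on_def)

lemma down_closed_nat_set: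
  fixes A :: "nat set"
  assumes "finite A" and down: "\<And>m. Suc m \<in> A \<Longrightarrow> m \<in> A"
  shows "A = {..<card A}"
proof (rule card_subset_eq)
  show "A \<subseteq> {..<card A}"
  proof
    fix i assume "i \<in> A"
    have "j \<in> A" if "j \<le> i" for j
      using that \<open>i \<in> A\<close> by (induction rule: inc_induct) (auto intro: down)
    then have "{..i} \<subseteq> A" by auto
    then have "card {..i} \<le> card A" using assms(1) by (rule card_mono[rotated])
    then show "i \<in> {..<card A}" by simp
  qed
qed auto

text \<open>
  Composing with an adjacent transposition of rows or of columns lowers one of the two index
  sums by one and flips the sign, until both index sets are initial segments; then the
  permutation is the identity.
\<close>
lemma sign_two_block_shuffle:
  assumes "\<tau> permutes {0..<d}" "A \<subseteq> {0..<d}"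
    and "strict_mono_on A \<tau>" "strict_mono_on ({0..<d} - A) \<tau>"
  shows "sign \<tau> = (- 1) ^ (\<Sum>A + \<Sum>(\<tau> ` A))"
  using assms
proof (induction "\<Sum>A + \<Sum>(\<tau> ` A)" arbitrary: A \<tau> rule: less_induct)
  case less
  note \<tau> = less.prems(1) and A = less.prems(2) and mono = less.prems(3) and mono' = less.prems(4)
  let ?D = "{0..<d}"
  have fin: "finite A" "finite (\<tau> ` A)" using A finite_subset by auto
  have \<tau>A: "\<tau> ` A \<subseteq> ?D" using image_mono[OF A, of \<tau>] permutes_image[OF \<tau>] by simp
  have \<tau>A': "\<tau> ` (?D - A) = ?D - \<tau> ` A"
    using permutes_inj[OF \<tau>] permutes_image[OF \<tau>] by (simp add: image_set_diff)
  \<comment> \<open>A gap below an element of \<open>A\<close> is handled by composing on the right,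
    which changes \<open>A\<close> but not its image; a gap in the image by composing on the left,
    which keeps \<open>A\<close>. Without gaps both sets are initial segments.\<close>
  consider m where "Suc m \<in> A" "m \<notin> A" | m where "Suc m \<in> \<tau> ` A" "m \<notin> \<tau> ` A"
    | "\<forall>m. Suc m \<in> A \<longrightarrow> m \<in> A" "\<forall>m. Suc m \<in> \<tau> ` A \<longrightarrow> m \<in> \<tau> ` A"
    by blast
  then show ?case
  proof cases
    case 1
    let ?s = "Transposition.transpose m (Suc m)"
    have s: "?s permutes ?D" using 1 A by (intro permutes_swap_id) auto
    have s_compl: "?D - ?s ` A = ?s ` (?D - A)"
      using permutes_inj[OF s] permutes_image[OF s] by (simp add: image_set_diff)
    have ss: "?s ` ?s ` X = X" for X by (simp add: image_comp)
    \<comment> \<open>After the swap the row set lacks \<open>Suc m\<close> and its complement lacks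
      \<open>m\<close>. Hence the transposition is increasing on each of the two, and composing with
      it keeps the shuffle property.\<close>
    have notin: "Suc m \<notin> ?s ` A" "m \<notin> ?s ` (?D - A)"
      using 1 by (auto simp: Transposition.transpose_def split: if_splits)
    have image: "(\<tau> \<circ> ?s) ` (?s ` A) = \<tau> ` A" by (metis image_comp ss)
    have sum: "Suc (\<Sum>(?s ` A)) = \<Sum>A" using fin(1) 1 by (rule sum_transpose_Suc_image)
    have "sign (\<tau> \<circ> ?s) = (- 1) ^ (\<Sum>(?s ` A) + \<Sum>((\<tau> \<circ> ?s) ` (?s ` A)))"
    proof (rule less.hyps)
      show "\<Sum>(?s ` A) + \<Sum>((\<tau> \<circ> ?s) ` (?s ` A)) < \<Sum>A + \<Sum>(\<tau> ` A)"
        unfolding image using sum by simp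
      show "\<tau> \<circ> ?s permutes ?D" using s \<tau> by (rule permutes_compose)
      show "?s ` A \<subseteq> ?D" using image_mono[OF A, of ?s] permutes_image[OF s] by simp
      show "strict_mono_on (?s ` A) (\<tau> \<circ> ?s)"
        using mono notin by (intro strict_mono_on_comp strict_mono_on_transpose_Suc) (auto simp: ss)
      show "strict_mono_on (?D - ?s ` A) (\<tau> \<circ> ?s)"
        unfolding s_compl
        using mono' notin by (intro strict_mono_on_comp strict_mono_on_transpose_Suc) (auto simp: ss)
    qed
    moreover have "sign (\<tau> \<circ> ?s) = - sign \<tau>"
      using \<tau> by (subst sign_compose) (auto intro: permutes_imp_permutation permutation_swap_id simp: sign_swap_id)
    ultimately show ?thesis unfolding image sum[symmetric] by simp
  next
    case 2
    let ?s = "Transposition.transpose m (Suc m)"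
    have s: "?s permutes ?D" using 2 \<tau>A by (intro permutes_swap_id) auto
    have image: "(?s \<circ> \<tau>) ` A = ?s ` \<tau> ` A" by (rule image_comp[symmetric])
    have sum: "Suc (\<Sum>(?s ` \<tau> ` A)) = \<Sum>(\<tau> ` A)" using fin(2) 2 by (rule sum_transpose_Suc_image)
    have "sign (?s \<circ> \<tau>) = (- 1) ^ (\<Sum>A + \<Sum>((?s \<circ> \<tau>) ` A))"
    proof (rule less.hyps)
      show "\<Sum>A + \<Sum>((?s \<circ> \<tau>) ` A) < \<Sum>A + \<Sum>(\<tau> ` A)"
        unfolding image using sum by simp
      show "?s \<circ> \<tau> permutes ?D" using \<tau> s by (rule permutes_compose)
      show "strict_mono_on A (?s \<circ> \<tau>)"
        using mono 2 by (intro strict_mono_on_comp strict_mono_on_transpose_Suc) auto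
      show "strict_mono_on (?D - A) (?s \<circ> \<tau>)"
        using mono' 2 by (intro strict_mono_on_comp strict_mono_on_transpose_Suc) (auto simp: \<tau>A')
    qed (rule A)
    moreover have "sign (?s \<circ> \<tau>) = - sign \<tau>"
      using \<tau> by (subst sign_compose) (auto intro: permutes_imp_permutation permutation_swap_id simp: sign_swap_id)
    ultimately show ?thesis unfolding image sum[symmetric] by simp
  next
    case 3
    \<comment> \<open>Two initial segments of equal size coincide, so \<tau> maps \<open>A\<close>
      and its complement onto themselves. Being increasing on both, it is the identity.\<close>
    have "card (\<tau> ` A) = card A"
      by (rule card_image[OF strict_mono_on_imp_inj_on[OF mono]])
    then have eq: "\<tau> ` A = A"
      using down_closed_nat_set[OF fin(1)] down_closed_nat_set[OF fin(2)] 3 by metis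
    have "\<tau> i = i" for i
    proof -
      consider "i \<in> A" | "i \<in> ?D - A" | "i \<notin> ?D" by blast
      then show ?thesis
      proof cases
        case 1
        with strict_mono_on_image_unique[OF mono strict_mono_on_id] eq show ?thesis by simp
      next
        case 2
        with strict_mono_on_image_unique[OF mono' strict_mono_on_id] eq \<tau>A' show ?thesis by simp
      next
        case 3
        with permutes_not_in[OF \<tau>] show ?thesis by simp
      qed
    qed
    then have "\<tau> = id" by auto
    \<comment> \<open>The two index sums are equal, so the exponent is even, in agreement with the
      sign of the identity.\<close>
    then show ?thesis by (simp add: eq flip: mult_2)
  qed
qed

section \<open>Two summands: shuffles as pairs of index sets\<close>

lemma atLeastAtMost_1_2: "{1..2} = {1, 2 :: nat}"
  by auto

text \<open>The first block determines the second as its complement, and extensionality fixes all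
  values outside \<open>{1..2}\<close>.\<close>

lemma bij_betw_ordered_partitions_2:
  "bij_betw (\<lambda>A. \<lambda>k\<in>{1..2}. if k = 1 then A else {0..<d} - A) (Pow {0..<d}) (ordered_partitions 2 d)"
proof (rule bij_betw_byWitness[where f' = "\<lambda>I. I 1"])
  show "\<forall>I\<in>ordered_partitions 2 d. (\<lambda>k\<in>{1..2}. if k = 1 then I 1 else {0..<d} - I 1) = I"
  proof
    fix I assume I: "I \<in> ordered_partitions 2 d"
    have "I 2 = {0..<d} - I 1"
      using ordered_partitionsD(1,2)[OF I]
      unfolding atLeastAtMost_1_2 disjoint_family_on_def by auto
    moreover have "I k = undefined" if "k \<notin> {1..2}" for k
      using I that unfolding ordered_partitions_def by (blast intro: PiE_arb)
    ultimately show "(\<lambda>k\<in>{1..2}. if k = 1 then I 1 else {0..<d} - I 1) = I"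
      unfolding atLeastAtMost_1_2 restrict_def by (intro ext) auto
  qed
qed (auto simp: ordered_partitions_def disjoint_family_on_def atLeastAtMost_1_2
    simp del: One_nat_def split: if_splits)

lemma mem_shuffle_perms_2:
  "\<tau> \<in> shuffle_perms 2 d (\<lambda>k\<in>{1..2}. if k = 1 then A else {0..<d} - A) \<longleftrightarrow>
    \<tau> permutes {0..<d} \<and> strict_mono_on A \<tau> \<and> strict_mono_on ({0..<d} - A) \<tau>"
  by (auto simp: shuffle_perms_def atLeastAtMost_1_2)

text \<open>The image of \<open>A\<close> also fixes the image of the complement, and an increasing
  map is determined by its image, which gives injectivity. Any \<open>B\<close> of the right size
  occurs, by gluing increasing maps on \<open>A\<close> and on its complement.\<close>

lemma bij_betw_shuffle_perms_2:
  assumes A: "A \<subseteq> {0..<d}"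
  shows "bij_betw (\<lambda>\<tau>. \<tau> ` A) (shuffle_perms 2 d (\<lambda>k\<in>{1..2}. if k = 1 then A else {0..<d} - A))
    {B. B \<subseteq> {0..<d} \<and> card B = card A}" (is "bij_betw _ (shuffle_perms 2 d ?I) _")
proof -
  let ?D = "{0..<d}"
  note T = mem_shuffle_perms_2[of _ d A]
  have compl: "\<tau> ` (?D - A) = ?D - \<tau> ` A" if "\<tau> permutes ?D" for \<tau>
    using permutes_inj[OF that] permutes_image[OF that] by (simp add: image_set_diff)
  have "inj_on (\<lambda>\<tau>. \<tau> ` A) (shuffle_perms 2 d ?I)"
  proof (rule inj_onI)
    fix \<tau> \<tau>' assume \<tau>: "\<tau> \<in> shuffle_perms 2 d ?I" and \<tau>': "\<tau>' \<in> shuffle_perms 2 d ?I"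
      and eq: "\<tau> ` A = \<tau>' ` A"
    have eq': "\<tau> ` (?D - A) = \<tau>' ` (?D - A)"
      using eq \<tau> \<tau>' unfolding T by (simp add: compl)
    show "\<tau> = \<tau>'"
    proof
      fix i
      consider "i \<in> A" | "i \<in> ?D - A" | "i \<notin> ?D" by blast
      then show "\<tau> i = \<tau>' i"
        by cases (use \<tau>[unfolded T] \<tau>'[unfolded T] eq eq' in
          \<open>auto simp: permutes_not_in intro: strict_mono_on_image_unique\<close>)
    qed
  qed
  moreover have "(\<lambda>\<tau>. \<tau> ` A) ` shuffle_perms 2 d ?I = {B. B \<subseteq> ?D \<and> card B = card A}"
  proof
    show "(\<lambda>\<tau>. \<tau> ` A) ` shuffle_perms 2 d ?I \<subseteq> {B. B \<subseteq> ?D \<and> card B = card A}"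
    proof clarify
      fix \<tau> assume "\<tau> \<in> shuffle_perms 2 d ?I"
      then have \<tau>: "\<tau> permutes ?D" unfolding T by simp
      show "\<tau> ` A \<subseteq> ?D \<and> card (\<tau> ` A) = card A"
        using image_mono[OF A, of \<tau>] permutes_image[OF \<tau>] card_image[OF permutes_inj_on[OF \<tau>]]
        by simp
    qed
    show "{B. B \<subseteq> ?D \<and> card B = card A} \<subseteq> (\<lambda>\<tau>. \<tau> ` A) ` shuffle_perms 2 d ?I"
    proof clarify
      fix B assume B: "B \<subseteq> ?D" "card B = card A"
      \<comment> \<open>The two blocks and their intended images are indexed by \<open>bool\<close>,
        to fit the gluing lemma with all of \<open>UNIV\<close> as index set.\<close>
      define I' J' where "I' b = (if b then A else ?D - A)" and "J' b = (if b then B else ?D - B)" for b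
      have "card (?D - A) = card (?D - B)"
        using A B by (simp add: card_Diff_subset finite_subset)
      then have "\<And>b. card (I' b) = card (J' b)" using B by (simp add: I'_def J'_def)
      moreover have "disjoint_family I'" "disjoint_family J'"
        by (auto simp: disjoint_family_on_def I'_def J'_def)
      moreover have "(\<Union>b. I' b) = ?D" "(\<Union>b. J' b) = ?D"
        using A B by (auto simp: I'_def J'_def split: if_splits)
      ultimately obtain \<tau> where \<tau>: "\<tau> permutes ?D" "\<And>b. strict_mono_on (I' b) \<tau>"
          "\<And>b. \<tau> ` I' b = J' b"
        using ex_blockwise_strict_mono_permutation[of ?D I' UNIV J'] by (metis UNIV_I finite_atLeastLessThan)
      then have "\<tau> \<in> shuffle_perms 2 d ?I" "\<tau> ` A = B"
        using \<tau>(2)[of True] \<tau>(2)[of False] \<tau>(3)[of True] unfolding T by (simp_all add: I'_def J'_def)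
      then show "B \<in> (\<lambda>\<tau>. \<tau> ` A) ` shuffle_perms 2 d ?I" by blast
    qed
  qed
  ultimately show ?thesis by (simp add: bij_betw_def)
qed

text \<open>In the expansion for two summands, a partition becomes its first block \<open>I\<close>
  and a shuffle becomes the image \<open>J\<close> of that block. The exponent is written with
  \<open>Suc\<close> because the indices start at 0.\<close>

theorem det_add_mat:
  fixes M N :: "'r::comm_ring_1 mat"
  assumes M: "M \<in> carrier_mat d d" and N: "N \<in> carrier_mat d d"
  shows "det (M + N) =
    (\<Sum>(I, J)\<in>{(I, J). I \<subseteq> {0..<d} \<and> J \<subseteq> {0..<d} \<and> card I = card J}.
      (- 1) ^ ((\<Sum>i\<in>I. Suc i) + (\<Sum>j\<in>J. Suc j))
      * minor I J M * minor ({0..<d} - I) ({0..<d} - J) N)"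
proof -
  let ?D = "{0..<d}"
  let ?L = "\<lambda>k :: nat. if k = 1 then M else N"
  let ?I = "\<lambda>A. \<lambda>k\<in>{1..2}. if k = 1 then A else ?D - A"
  let ?h = "\<lambda>I J. (- 1) ^ ((\<Sum>i\<in>I. Suc i) + (\<Sum>j\<in>J. Suc j))
      * minor I J M * minor (?D - I) (?D - J) N"
  have L: "?L k \<in> carrier_mat d d" for k using M N by simp
  let ?S = "finsum (module_mat TYPE('r) d d) ?L {1..2}"
  have S: "?S \<in> carrier_mat d d"
    using L by (intro index_finsum_mat) auto
  have "M + N = ?S"
  proof (rule eq_matI)
    fix i j assume "i < dim_row ?S" "j < dim_col ?S"
    then have ij: "i < d" "j < d" using S by auto
    then have "?S $$ (i, j) = (\<Sum>k\<in>{1..2}. ?L k $$ (i, j))"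
      using L by (intro index_finsum_mat) auto
    then show "(M + N) $$ (i, j) = ?S $$ (i, j)"
      unfolding atLeastAtMost_1_2 using M N ij by simp
  qed (use M N S in auto)
  then have "det (M + N) = (\<Sum>I\<in>ordered_partitions 2 d. \<Sum>\<sigma>\<in>shuffle_perms 2 d I.
      of_int (sign \<sigma>) * (\<Prod>k\<in>{1..2}. minor (I k) (\<sigma> ` I k) (?L k)))"
    using det_finsum_mat[of 2 ?L d] L by simp
  also have "\<dots> = (\<Sum>A\<in>Pow ?D. \<Sum>\<sigma>\<in>shuffle_perms 2 d (?I A).
      of_int (sign \<sigma>) * (\<Prod>k\<in>{1..2}. minor (?I A k) (\<sigma> ` ?I A k) (?L k)))"
    by (rule sum.reindex_bij_betw[OF bij_betw_ordered_partitions_2, symmetric])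
  also have "\<dots> = (\<Sum>A\<in>Pow ?D. \<Sum>\<sigma>\<in>shuffle_perms 2 d (?I A). ?h A (\<sigma> ` A))"
  proof (intro sum.cong refl)
    fix A \<sigma> assume "A \<in> Pow ?D" and \<sigma>': "\<sigma> \<in> shuffle_perms 2 d (?I A)"
    then have A: "A \<subseteq> ?D" and \<sigma>: "\<sigma> permutes ?D" "strict_mono_on A \<sigma>" "strict_mono_on (?D - A) \<sigma>"
      unfolding mem_shuffle_perms_2 by auto
    have "\<sigma> ` (?D - A) = ?D - \<sigma> ` A"
      using permutes_inj[OF \<sigma>(1)] permutes_image[OF \<sigma>(1)] by (simp add: image_set_diff)
    then have "(\<Prod>k\<in>{1..2}. minor (?I A k) (\<sigma> ` ?I A k) (?L k)) =
        minor A (\<sigma> ` A) M * minor (?D - A) (?D - \<sigma> ` A) N"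
      unfolding atLeastAtMost_1_2 by simp
    \<comment> \<open>Passing from indices counted from 0 to indices counted from 1 adds
      \<open>card A\<close> to each of the two sums. The total change is even and leaves the sign
      alone.\<close>
    moreover have "card (\<sigma> ` A) = card A"
      by (rule card_image[OF permutes_inj_on[OF \<sigma>(1)]])
    then have "(\<Sum>i\<in>A. Suc i) + (\<Sum>j\<in>\<sigma> ` A. Suc j) = \<Sum>A + \<Sum>(\<sigma> ` A) + 2 * card A"
      by (simp add: sum_Suc)
    then have "of_int (sign \<sigma>) = ((- 1) ^ ((\<Sum>i\<in>A. Suc i) + (\<Sum>j\<in>\<sigma> ` A. Suc j)) :: 'r)"
      using sign_two_block_shuffle[OF \<sigma>(1) A \<sigma>(2,3)] by (simp add: power_add)
    ultimately show "of_int (sign \<sigma>) * (\<Prod>k\<in>{1..2}. minor (?I A k) (\<sigma> ` ?I A k) (?L k)) =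
        ?h A (\<sigma> ` A)"
      by (simp add: mult.assoc)
  qed
  \<comment> \<open>The summand depends on the shuffle only through the image of \<open>A\<close>,
    so the shuffles can be replaced by the column sets \<open>B\<close>.\<close>
  also have "\<dots> = (\<Sum>A\<in>Pow ?D. \<Sum>B | B \<subseteq> ?D \<and> card B = card A. ?h A B)"
    by (intro sum.cong refl sum.reindex_bij_betw bij_betw_shuffle_perms_2) auto
  also have "\<dots> = (\<Sum>(A, B)\<in>(SIGMA A:Pow ?D. {B. B \<subseteq> ?D \<and> card B = card A}). ?h A B)"
    by (rule sum.Sigma) auto
  also have "(SIGMA A:Pow ?D. {B. B \<subseteq> ?D \<and> card B = card A}) =
      {(I, J). I \<subseteq> ?D \<and> J \<subseteq> ?D \<and> card I = card J}"
    by auto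
  finally show ?thesis .
qed

theorem lemma5p11:
  fixes \<iota> :: "'k::field \<Rightarrow> 'r::comm_ring_1"
    and d n :: nat
    and M :: "nat \<Rightarrow> 'r mat"
  assumes perfect: "perfect_field TYPE('k)"
    and algebra: "comm_ring_hom \<iota>"
    and M: "\<And>k. k \<in> {1..n} \<Longrightarrow> M k \<in> carrier_mat d d"
  shows "det (finsum (module_mat TYPE('r) d d) M {1..n}) =
           (\<Sum>I\<in>ordered_partitions n d. \<Sum>\<sigma>\<in>shuffle_perms n d I.
              signof \<sigma> * (\<Prod>k\<in>{1..n}. minor (I k) (\<sigma> ` I k) (M k)))
       \<and> (\<forall>A\<in>carrier_mat d d. \<forall>B\<in>carrier_mat d d.
            det (A + B) =
              (\<Sum>(I, J)\<in>{(I, J). I \<subseteq> {0..<d} \<and> J \<subseteq> {0..<d} \<and> card I = card J}.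
                 (-1) ^ ((\<Sum>i\<in>I. Suc i) + (\<Sum>j\<in>J. Suc j))
                 * minor I J A * minor ({0..<d} - I) ({0..<d} - J) (B :: 'r mat)))"
  by (intro conjI ballI det_finsum_mat[OF M] det_add_mat)

end
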